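(* Let $G$ be a finite connected graph. Then $B(G) = 1$ if and only if $G\cong P_2$. Furthermore, $B(G) = 2$ if and only if either $G \cong P_n$ for some $n\geq 3$ or $G\cong C_m$ for some $3\leq m\leq 5$.
   Context: $P_n$ is the path on $n$ vertices and $C_m$ the cycle on $m$ vertices. Bodyguards and Presidents is a two-player game on a finite simple graph $G$. One player controls a set of tokens called bodyguards, the other a single token called the president. First all bodyguards are placed on vertices (several may share a vertex), then the president is placed. The players then alternate turns, bodyguards first; on a player's turn, each token they control either moves to an adjacent vertex or stays put. The president is surrounded if every vertex of the open neighbourhood of the president's vertex is occupied by a bodyguard. The bodyguards win if there is a finite time after which, at the end of every bodyguard turn, the president is surrounded; otherwise the president wins. The bodyguard number $B(G)$ is the minimum number of bodyguards that guarantees a win for the bodyguards on $G$. *)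

theory Defs
  imports "Graph_Theory.Pair_Digraph" "Graph_Theory.Digraph_Isomorphism"
begin

definition path_graph :: "nat \<Rightarrow> nat pair_pre_digraph" where
  "path_graph n =
    \<lparr> pverts = {..<n},
      parcs = {(i, j). i < n \<and> j < n \<and> (j = Suc i \<or> i = Suc j)} \<rparr>"

text \<open>For \<open>m < 3\<close> this is not a cycle in the usual sense (\<open>m = 1\<close> yields a loop and
  \<open>m = 2\<close> a single edge).\<close>

definition cycle_graph :: "nat \<Rightarrow> nat pair_pre_digraph" where
  "cycle_graph m =
    \<lparr> pverts = {..<m},
      parcs = {(i, j). i < m \<and> j < m \<and> (j = Suc i mod m \<or> i = Suc j mod m)} \<rparr>"

definition open_nbhd :: "'a pair_pre_digraph \<Rightarrow> 'a \<Rightarrow> 'a set" where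
  "open_nbhd G v = {w. (v, w) \<in> parcs G}"

definition token_move :: "'a pair_pre_digraph \<Rightarrow> 'a \<Rightarrow> 'a \<Rightarrow> bool" where
  "token_move G v w \<longleftrightarrow> w = v \<or> w \<in> open_nbhd G v"

text \<open>The positions of \<open>k\<close> bodyguards are a list of length \<open>k\<close>, whose \<open>i\<close>-th entry is the
  vertex of the \<open>i\<close>-th bodyguard; repetitions are allowed.\<close>

definition surrounded :: "'a pair_pre_digraph \<Rightarrow> 'a list \<Rightarrow> 'a \<Rightarrow> bool" where
  "surrounded G gs v \<longleftrightarrow> open_nbhd G v \<subseteq> set gs"

text \<open>A play of the president is the sequence of his positions: \<open>p 0\<close> is his initial vertex and
  \<open>p t\<close> his vertex after his \<open>t\<close>-th turn.\<close>

definition president_play :: "'a pair_pre_digraph \<Rightarrow> (nat \<Rightarrow> 'a) \<Rightarrow> bool" where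
  "president_play G p \<longleftrightarrow> p 0 \<in> pverts G \<and> (\<forall>t. token_move G (p t) (p (Suc t)))"

text \<open>A strategy \<open>\<sigma>\<close> of the bodyguards maps what the president has done so far to the positions
  of the bodyguards: \<open>\<sigma> []\<close> is the initial placement, made before the president is placed, and
  \<open>\<sigma> [p 0, \<dots>, p t]\<close> are the positions after the bodyguards' turn that answers the president's
  being at \<open>p t\<close>. The earlier bodyguard positions are determined by \<open>\<sigma>\<close> and the president's
  history, so they are not arguments of \<open>\<sigma>\<close>. As \<open>\<sigma>\<close> is deterministic, quantifying over all
  plays \<open>p\<close> covers presidents who react to the bodyguards.\<close>

definition guards_at :: "('a list \<Rightarrow> 'a list) \<Rightarrow> (nat \<Rightarrow> 'a) \<Rightarrow> nat \<Rightarrow> 'a list" where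
  "guards_at \<sigma> p t = \<sigma> (map p [0..<t])"

definition bodyguard_strategy ::
  "'a pair_pre_digraph \<Rightarrow> nat \<Rightarrow> ('a list \<Rightarrow> 'a list) \<Rightarrow> bool" where
  "bodyguard_strategy G k \<sigma> \<longleftrightarrow>
    length (\<sigma> []) = k \<and> set (\<sigma> []) \<subseteq> pverts G \<and>
    (\<forall>p. president_play G p \<longrightarrow>
      (\<forall>t. list_all2 (token_move G) (guards_at \<sigma> p t) (guards_at \<sigma> p (Suc t))))"

text \<open>Bodyguard turn \<open>t + 1\<close> takes place while the president is at \<open>p t\<close> and ends with the
  bodyguards at \<open>guards_at \<sigma> p (Suc t)\<close>.\<close>

definition bodyguards_win_play ::
  "'a pair_pre_digraph \<Rightarrow> ('a list \<Rightarrow> 'a list) \<Rightarrow> (nat \<Rightarrow> 'a) \<Rightarrow> bool" where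
  "bodyguards_win_play G \<sigma> p \<longleftrightarrow>
    (\<exists>N. \<forall>t\<ge>N. surrounded G (guards_at \<sigma> p (Suc t)) (p t))"

definition bodyguards_win :: "'a pair_pre_digraph \<Rightarrow> nat \<Rightarrow> bool" where
  "bodyguards_win G k \<longleftrightarrow>
    (\<exists>\<sigma>. bodyguard_strategy G k \<sigma> \<and>
      (\<forall>p. president_play G p \<longrightarrow> bodyguards_win_play G \<sigma> p))"

text \<open>Zero bodyguards are allowed, so the one-vertex graph has bodyguard number 0. The minimum is
  over a nonempty set by the lemma that follows.\<close>

definition bodyguard_number :: "'a pair_pre_digraph \<Rightarrow> nat" where
  "bodyguard_number G = (LEAST k. bodyguards_win G k)"

lemma bodyguards_win_card:
  assumes "pair_graph G"
  shows "bodyguards_win G (card (pverts G))"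
proof -
  interpret pair_graph G by fact
  obtain gs where gs: "set gs = pverts G" "distinct gs"
    using finite_distinct_list[OF pair_finite_verts] by blast
  have "bodyguard_strategy G (card (pverts G)) (\<lambda>_. gs)"
    using gs distinct_card[OF gs(2)]
    by (auto simp: bodyguard_strategy_def guards_at_def token_move_def list_all2_same)
  moreover have "surrounded G gs v" for v
    using gs in_arcsD2 by (auto simp: surrounded_def open_nbhd_def)
  ultimately show ?thesis
    unfolding bodyguards_win_def bodyguards_win_play_def guards_at_def by blast
qed

end

theory Submission
  imports Defs
begin

text \<open>A president who never moves shows that \<open>k\<close> winning bodyguards force all degrees to be at most
  \<open>k\<close>, so for \<open>k \<le> 2\<close> the graph is a path or a cycle. On a path, two guards close in from both ends.
  On a cycle of length at most 5 they surround the president in their first turn and then copy his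
  moves. On a longer cycle, call a position threatening if the guards can surround the president in
  one turn. From any position in which he is not surrounded, one of his three moves leads to a
  position that is not threatening, so he is never surrounded.\<close>

section \<open>Isomorphisms of pair graphs\<close>

text \<open>On a cycle everything is measured by offsets from the president modulo \<open>m\<close>.
  A position is threatening when one guard has offset in \<open>{-2, -1, 0}\<close> and the other in
  \<open>{0, 1, 2}\<close>; he is surrounded at the offsets -1 and 1. A step by 1 or -1 shifts both
  offsets the other way and can leave a lagging guard at -3 or 3. This puts that guard out of play
  only if -3 and 3 are congruent to none of -2, ..., 2, that is, if m \<ge> 6: on a 5-cycle the
  offset -3 is also 2, so a guard left behind already closes in from the front. The numbers are
  computed on concrete graphs with vertices \<open>{..<n}\<close>, so winning has to be carried
  along isomorphisms. The forward implications then come from comparing values: a connected graph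
  with number at most 2 is isomorphic to some concrete path or cycle, and the number of that graph
  decides which ones remain.\<close>

definition pair_isomorphism ::
  "('a \<Rightarrow> 'b) \<Rightarrow> 'a pair_pre_digraph \<Rightarrow> 'b pair_pre_digraph \<Rightarrow> bool" where
  "pair_isomorphism f G H \<longleftrightarrow>
    bij_betw f (pverts G) (pverts H) \<and>
    (\<forall>u\<in>pverts G. \<forall>v\<in>pverts G. (u, v) \<in> parcs G \<longleftrightarrow> (f u, f v) \<in> parcs H)"

lemma pair_isomorphism_the_inv_into:
  assumes "pair_isomorphism f G H"
  shows "pair_isomorphism (the_inv_into (pverts G) f) H G"
proof -
  have bij: "bij_betw f (pverts G) (pverts H)"
    using assms by (simp add: pair_isomorphism_def)
  have inv: "the_inv_into (pverts G) f x \<in> pverts G" "f (the_inv_into (pverts G) f x) = x"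
    if "x \<in> pverts H" for x
    using that bij bij_betwE[OF bij_betw_the_inv_into[OF bij]] f_the_inv_into_f_bij_betw[OF bij]
    by auto
  show ?thesis
    using assms bij_betw_the_inv_into[OF bij] inv by (simp add: pair_isomorphism_def)
qed

text \<open>An arc of a pair graph is the pair of its ends, so the vertex map determines what
  happens to the arcs and the arc map of a general isomorphism carries no further
  information.\<close>

lemma digraph_iso_with_proj_iff:
  assumes "pair_wf_digraph G" "pair_wf_digraph H"
  shows "digraph_iso (with_proj G) (with_proj H) \<longleftrightarrow> (\<exists>f. pair_isomorphism f G H)"
proof
  assume "digraph_iso (with_proj G) (with_proj H)"
  then obtain h where h: "pre_digraph.digraph_isomorphism (with_proj G) h"
      "with_proj H = app_iso h (with_proj G)"
    by (auto simp: digraph_iso_def)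
  let ?f = "iso_verts h"
  have verts: "pverts H = ?f ` pverts G"
    using arg_cong[OF h(2), of verts] by simp
  have arcs: "parcs H = (\<lambda>(u, v). (?f u, ?f v)) ` parcs G"
    using arg_cong[OF h(2), of arcs_ends] wf_digraph.arcs_ends_app_iso_eq[OF _ h(1)] assms(1)
    by (simp add: wf_digraph_wp_iff)
  have inj: "inj_on ?f (pverts G)"
    using pre_digraph.digraph_isomorphism_inj_on_verts[OF h(1)] by simp
  have "(?f u, ?f v) \<in> parcs H" if "(u, v) \<in> parcs G" for u v
    using that arcs by force
  moreover have "(u, v) \<in> parcs G"
    if "u \<in> pverts G" "v \<in> pverts G" "(?f u, ?f v) \<in> parcs H" for u v
  proof -
    from that(3) arcs obtain x y where xy: "(x, y) \<in> parcs G" "?f x = ?f u" "?f y = ?f v"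
      by auto
    then have "x \<in> pverts G" "y \<in> pverts G"
      using assms(1) pair_wf_digraph.arc_fst_in_verts pair_wf_digraph.arc_snd_in_verts
      by fastforce+
    with xy that inj show ?thesis by (metis inj_onD)
  qed
  ultimately have "pair_isomorphism ?f G H"
    using verts inj unfolding pair_isomorphism_def bij_betw_def by blast
  then show "\<exists>f. pair_isomorphism f G H" by blast
next
  assume "\<exists>f. pair_isomorphism f G H"
  then obtain f where f: "pair_isomorphism f G H" ..
  interpret G: pair_wf_digraph G by fact
  interpret H: pair_wf_digraph H by fact
  \<comment> \<open>Head and tail are chosen as the projections of \<open>with_proj\<close>, so that
    \<open>app_iso\<close> yields \<open>with_proj H\<close> itself and not merely a copy of
    it.\<close>
  let ?h = "\<lparr>iso_verts = f, iso_arcs = map_prod f f, iso_head = snd, iso_tail = fst\<rparr>"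
  have inj: "inj_on f (pverts G)" and verts: "pverts H = f ` pverts G"
    using f by (auto simp: pair_isomorphism_def bij_betw_def)
  have sub: "parcs G \<subseteq> pverts G \<times> pverts G"
    using G.arc_fst_in_verts G.arc_snd_in_verts by fastforce
  have "inj_on (map_prod f f) (parcs G)"
    using map_prod_inj_on[OF inj inj] sub by (rule inj_on_subset)
  then have "pre_digraph.digraph_isomorphism (with_proj G) ?h"
    using inj G.wf_digraph_axioms by (auto simp: pre_digraph.digraph_isomorphism_def)
  moreover have "parcs H = map_prod f f ` parcs G"
  proof
    show "map_prod f f ` parcs G \<subseteq> parcs H"
      using f sub by (auto simp: pair_isomorphism_def)
    show "parcs H \<subseteq> map_prod f f ` parcs G"
    proof
      fix e assume e: "e \<in> parcs H"
      then have "fst e \<in> f ` pverts G" "snd e \<in> f ` pverts G"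
        using H.arc_fst_in_verts H.arc_snd_in_verts verts by auto
      then obtain u v where uv: "u \<in> pverts G" "v \<in> pverts G" "e = (f u, f v)"
        by (metis imageE prod.collapse)
      with f e have "(u, v) \<in> parcs G" by (auto simp: pair_isomorphism_def)
      with uv show "e \<in> map_prod f f ` parcs G" by (auto intro!: rev_image_eqI)
    qed
  qed
  then have "with_proj H = app_iso ?h (with_proj G)"
    using verts by (simp add: with_proj_def app_iso_def)
  ultimately show "digraph_iso (with_proj G) (with_proj H)"
    unfolding digraph_iso_def by blast
qed

section \<open>Legal positions and transport of strategies\<close>

lemma open_nbhd_subset_pverts: "pair_wf_digraph G \<Longrightarrow> open_nbhd G v \<subseteq> pverts G"
  using pair_wf_digraph.arc_snd_in_verts by (fastforce simp: open_nbhd_def)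

lemma token_move_in_pverts:
  "pair_wf_digraph G \<Longrightarrow> token_move G v w \<Longrightarrow> v \<in> pverts G \<Longrightarrow> w \<in> pverts G"
  using open_nbhd_subset_pverts by (fastforce simp: token_move_def)

lemma president_play_in_pverts:
  assumes "pair_wf_digraph G" "president_play G p"
  shows "p t \<in> pverts G"
  using assms by (induction t) (auto simp: president_play_def intro: token_move_in_pverts)

lemma guards_at_legal:
  assumes "pair_wf_digraph G" "bodyguard_strategy G k \<sigma>" "president_play G p"
  shows "length (guards_at \<sigma> p t) = k \<and> set (guards_at \<sigma> p t) \<subseteq> pverts G"
proof (induction t)
  case 0
  then show ?case using assms(2) by (simp add: bodyguard_strategy_def guards_at_def)
next
  case (Suc t)
  have l: "list_all2 (token_move G) (guards_at \<sigma> p t) (guards_at \<sigma> p (Suc t))"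
    using assms(2,3) by (simp add: bodyguard_strategy_def)
  have "set (guards_at \<sigma> p (Suc t)) \<subseteq> pverts G"
  proof
    fix x assume "x \<in> set (guards_at \<sigma> p (Suc t))"
    then obtain i where i: "i < length (guards_at \<sigma> p (Suc t))" "x = guards_at \<sigma> p (Suc t) ! i"
      by (auto simp: in_set_conv_nth)
    then have "token_move G (guards_at \<sigma> p t ! i) x" "guards_at \<sigma> p t ! i \<in> pverts G"
      using l Suc by (auto simp: list_all2_conv_all_nth)
    then show "x \<in> pverts G" by (rule token_move_in_pverts[OF assms(1)])
  qed
  then show ?case using Suc l by (simp add: list_all2_lengthD)
qed

text \<open>The guards on \<open>H\<close> pull the president's history back along \<open>g\<close>,
  consult \<open>\<sigma>\<close>, and push its answer forward along \<open>f\<close>. Since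
  \<open>g\<close> turns plays on \<open>H\<close> into plays on \<open>G\<close>, legality and
  surrounding are inherited.\<close>

lemma bodyguards_win_pair_isomorphism:
  assumes wf: "pair_wf_digraph G" "pair_wf_digraph H"
    and f: "pair_isomorphism f G H" and win: "bodyguards_win G k"
  shows "bodyguards_win H k"
proof -
  define g where "g = the_inv_into (pverts G) f"
  have g: "pair_isomorphism g H G"
    unfolding g_def by (rule pair_isomorphism_the_inv_into[OF f])
  have bij: "bij_betw f (pverts G) (pverts H)" using f by (simp add: pair_isomorphism_def)
  have fg: "f (g x) = x" "g x \<in> pverts G" if "x \<in> pverts H" for x
    using that g f_the_inv_into_f_bij_betw[OF bij]
    by (auto simp: g_def pair_isomorphism_def bij_betw_def)
  have f_in: "f x \<in> pverts H" if "x \<in> pverts G" for x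
    using that bij by (auto simp: bij_betw_def)
  have move_f: "token_move H (f u) (f v)"
    if "token_move G u v" "u \<in> pverts G" for u v
    using that f token_move_in_pverts[OF wf(1) that]
    by (auto simp: token_move_def open_nbhd_def pair_isomorphism_def)
  have move_g: "token_move G (g u) (g v)"
    if "token_move H u v" "u \<in> pverts H" for u v
    using that g token_move_in_pverts[OF wf(2) that]
    by (auto simp: token_move_def open_nbhd_def pair_isomorphism_def)
  obtain \<sigma> where \<sigma>: "bodyguard_strategy G k \<sigma>"
      "\<And>p. president_play G p \<Longrightarrow> bodyguards_win_play G \<sigma> p"
    using win by (auto simp: bodyguards_win_def)
  define \<tau> where "\<tau> h = map f (\<sigma> (map g h))" for h
  have guards: "guards_at \<tau> p t = map f (guards_at \<sigma> (g \<circ> p) t)" for p t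
    by (simp add: \<tau>_def guards_at_def)
  have play: "president_play G (g \<circ> p)" if "president_play H p" for p
    using that president_play_in_pverts[OF wf(2) that]
    by (auto simp: president_play_def fg intro: move_g)
  have "bodyguard_strategy H k \<tau>"
    unfolding bodyguard_strategy_def
  proof (intro conjI allI impI)
    show "length (\<tau> []) = k" "set (\<tau> []) \<subseteq> pverts H"
      using \<sigma>(1) by (auto simp: \<tau>_def bodyguard_strategy_def intro: f_in)
    fix p t assume p: "president_play H p"
    have "list_all2 (token_move G) (guards_at \<sigma> (g \<circ> p) t) (guards_at \<sigma> (g \<circ> p) (Suc t))"
      using \<sigma>(1) play[OF p] by (simp add: bodyguard_strategy_def)
    then show "list_all2 (token_move H) (guards_at \<tau> p t) (guards_at \<tau> p (Suc t))"
      using guards_at_legal[OF wf(1) \<sigma>(1) play[OF p], of t] unfolding guards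
      by (auto simp: list_all2_conv_all_nth intro!: move_f)
  qed
  moreover have "bodyguards_win_play H \<tau> p" if p: "president_play H p" for p
  proof -
    have "surrounded H (guards_at \<tau> p (Suc t)) (p t)"
      if s: "surrounded G (guards_at \<sigma> (g \<circ> p) (Suc t)) ((g \<circ> p) t)" for t
      unfolding surrounded_def
    proof
      fix w assume w: "w \<in> open_nbhd H (p t)"
      then have "w \<in> pverts H" using open_nbhd_subset_pverts[OF wf(2)] by blast
      with w g president_play_in_pverts[OF wf(2) p] have "g w \<in> open_nbhd G (g (p t))"
        by (auto simp: open_nbhd_def pair_isomorphism_def)
      with s have "g w \<in> set (guards_at \<sigma> (g \<circ> p) (Suc t))" by (auto simp: surrounded_def)
      then show "w \<in> set (guards_at \<tau> p (Suc t))"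
        using fg[OF \<open>w \<in> pverts H\<close>] unfolding guards by (auto intro: rev_image_eqI)
    qed
    then show ?thesis using \<sigma>(2)[OF play[OF p]] by (auto simp: bodyguards_win_play_def)
  qed
  ultimately show ?thesis by (auto simp: bodyguards_win_def)
qed

lemma bodyguard_number_digraph_iso:
  assumes "pair_wf_digraph G" "pair_wf_digraph H" "digraph_iso (with_proj G) (with_proj H)"
  shows "bodyguard_number G = bodyguard_number H"
proof -
  obtain f where f: "pair_isomorphism f G H"
    using assms by (auto simp: digraph_iso_with_proj_iff)
  have "bodyguards_win G k \<longleftrightarrow> bodyguards_win H k" for k
    using bodyguards_win_pair_isomorphism[OF assms(1,2) f]
      bodyguards_win_pair_isomorphism[OF assms(2,1) pair_isomorphism_the_inv_into[OF f]]
    by blast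
  then show ?thesis by (simp add: bodyguard_number_def)
qed

section \<open>Winning criteria\<close>

text \<open>Replaces histories by three pieces of data: the president's first vertex
  \<open>u\<close>, the turn number \<open>t\<close> and his current vertex \<open>v\<close>. Paths
  need \<open>t\<close>, because the guards are still walking; cycles need \<open>u\<close>, which
  fixes once and for all which guard takes which side.\<close>

lemma bodyguards_winI:
  fixes resp :: "'a \<Rightarrow> nat \<Rightarrow> 'a \<Rightarrow> 'a list"
  assumes wf: "pair_wf_digraph G"
    and start: "length start = k" "set start \<subseteq> pverts G"
    and first: "\<And>u. u \<in> pverts G \<Longrightarrow> list_all2 (token_move G) start (resp u 0 u)"
    and step: "\<And>u t v w. u \<in> pverts G \<Longrightarrow> v \<in> pverts G \<Longrightarrow> w \<in> pverts G \<Longrightarrow> token_move G v w \<Longrightarrow>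
      list_all2 (token_move G) (resp u t v) (resp u (Suc t) w)"
    and surr: "\<And>u t v. u \<in> pverts G \<Longrightarrow> v \<in> pverts G \<Longrightarrow> N \<le> t \<Longrightarrow> surrounded G (resp u t v) v"
  shows "bodyguards_win G k"
proof -
  \<comment> \<open>The history up to \<open>p t\<close> has length \<open>t + 1\<close>, hence the
    \<open>- 1\<close>.\<close>
  define \<sigma> where "\<sigma> h = (if h = [] then start else resp (hd h) (length h - 1) (last h))" for h
  have \<sigma>_Suc: "guards_at \<sigma> p (Suc t) = resp (p 0) t (p t)" for p t
    by (simp add: guards_at_def \<sigma>_def hd_append hd_map)
  have \<sigma>_0: "guards_at \<sigma> p 0 = start" for p
    by (simp add: guards_at_def \<sigma>_def)
  have "bodyguard_strategy G k \<sigma>"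
    unfolding bodyguard_strategy_def
  proof (intro conjI allI impI)
    show "length (\<sigma> []) = k" "set (\<sigma> []) \<subseteq> pverts G" using start by (simp_all add: \<sigma>_def)
    fix p t assume p: "president_play G p"
    note in_verts = president_play_in_pverts[OF wf p]
    show "list_all2 (token_move G) (guards_at \<sigma> p t) (guards_at \<sigma> p (Suc t))"
    proof (cases t)
      case 0
      then show ?thesis by (simp add: \<sigma>_0 \<sigma>_Suc first in_verts)
    next
      case (Suc s)
      have "token_move G (p s) (p (Suc s))" using p by (simp add: president_play_def)
      then show ?thesis unfolding Suc \<sigma>_Suc by (intro step in_verts)
    qed
  qed
  moreover have "bodyguards_win_play G \<sigma> p" if "president_play G p" for p
    unfolding bodyguards_win_play_def \<sigma>_Suc
    using president_play_in_pverts[OF wf that] by (blast intro: surr)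
  ultimately show ?thesis by (auto simp: bodyguards_win_def)
qed

lemma bodyguards_win_imp_open_nbhd_subset:
  assumes "pair_wf_digraph G" "bodyguards_win G k" "v \<in> pverts G"
  shows "\<exists>gs. length gs = k \<and> open_nbhd G v \<subseteq> set gs"
proof -
  obtain \<sigma> where \<sigma>: "bodyguard_strategy G k \<sigma>"
      "\<And>p. president_play G p \<Longrightarrow> bodyguards_win_play G \<sigma> p"
    using assms(2) by (auto simp: bodyguards_win_def)
  have p: "president_play G (\<lambda>_. v)"
    using assms(3) by (simp add: president_play_def token_move_def)
  from \<sigma>(2)[OF p] obtain N where "surrounded G (guards_at \<sigma> (\<lambda>_. v) (Suc N)) v"
    by (auto simp: bodyguards_win_play_def)
  then show ?thesis
    using guards_at_legal[OF assms(1) \<sigma>(1) p] by (auto simp: surrounded_def)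
qed

lemma bodyguards_win_imp_card_open_nbhd_le:
  assumes "pair_wf_digraph G" "bodyguards_win G k" "v \<in> pverts G"
  shows "card (open_nbhd G v) \<le> k"
proof -
  obtain gs where "length gs = k" "open_nbhd G v \<subseteq> set gs"
    using bodyguards_win_imp_open_nbhd_subset[OF assms] by blast
  then show ?thesis
    by (metis List.finite_set card_length card_mono le_trans)
qed

text \<open>\<open>Safe gs v\<close> describes positions with the bodyguards to move.\<close>

lemma not_bodyguards_winI:
  assumes wf: "pair_wf_digraph G"
    and init: "\<And>gs. length gs = k \<Longrightarrow> set gs \<subseteq> pverts G \<Longrightarrow> \<exists>v\<in>pverts G. Safe gs v"
    and step: "\<And>gs gs' v. length gs = k \<Longrightarrow> set gs \<subseteq> pverts G \<Longrightarrow> set gs' \<subseteq> pverts G \<Longrightarrow>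
      v \<in> pverts G \<Longrightarrow> Safe gs v \<Longrightarrow> list_all2 (token_move G) gs gs' \<Longrightarrow>
      \<not> surrounded G gs' v \<and> (\<exists>w. token_move G v w \<and> Safe gs' w)"
  shows "\<not> bodyguards_win G k"
proof
  assume "bodyguards_win G k"
  then obtain \<sigma> where \<sigma>: "bodyguard_strategy G k \<sigma>"
      "\<And>p. president_play G p \<Longrightarrow> bodyguards_win_play G \<sigma> p"
    by (auto simp: bodyguards_win_def)
  obtain v0 where v0: "v0 \<in> pverts G" "Safe (\<sigma> []) v0"
    using init[of "\<sigma> []"] \<sigma>(1) unfolding bodyguard_strategy_def by blast
  \<comment> \<open>Staying at \<open>v\<close> is the default, so that \<open>nxt\<close> is a
    legal move even where no safe one exists.\<close>
  define nxt where "nxt gs v =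
    (if \<exists>w. token_move G v w \<and> Safe gs w then SOME w. token_move G v w \<and> Safe gs w else v)"
    for gs v
  have nxt_move: "token_move G v (nxt gs v)" for gs v
  proof (cases "\<exists>w. token_move G v w \<and> Safe gs w")
    case True
    then show ?thesis using someI_ex[OF True] by (simp add: nxt_def)
  next
    case False
    then have "nxt gs v = v" unfolding nxt_def by (rule if_not_P)
    then show ?thesis by (simp add: token_move_def)
  qed
  have nxt_safe: "Safe gs (nxt gs v)" if "\<exists>w. token_move G v w \<and> Safe gs w" for gs v
    using that someI_ex[OF that] by (simp add: nxt_def)
  \<comment> \<open>The president reacts to guards whose positions depend on his own whole history.
    Recursion on the history, instead of on his vertex, breaks this circle; \<open>p\<close> is then
    read off as the last entry.\<close>
  define H where "H = rec_nat [v0] (\<lambda>_ h. h @ [nxt (\<sigma> h) (last h)])"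
  define p where "p t = last (H t)" for t
  have H_simps: "H 0 = [v0]" "H (Suc t) = H t @ [nxt (\<sigma> (H t)) (last (H t))]" for t
    by (simp_all add: H_def)
  have H_eq: "map p [0..<Suc t] = H t" for t
    by (induction t) (simp_all add: H_simps p_def)
  have p_0: "p 0 = v0" by (simp add: p_def H_simps)
  have p_Suc: "p (Suc t) = nxt (guards_at \<sigma> p (Suc t)) (p t)" for t
    unfolding guards_at_def H_eq by (simp add: p_def H_simps)
  have p: "president_play G p"
    by (simp add: president_play_def p_0 v0 p_Suc nxt_move)
  have moves: "list_all2 (token_move G) (guards_at \<sigma> p t) (guards_at \<sigma> p (Suc t))" for t
    using \<sigma>(1) p by (simp add: bodyguard_strategy_def)
  note legal = guards_at_legal[OF wf \<sigma>(1) p]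
  have step': "\<not> surrounded G (guards_at \<sigma> p (Suc t)) (p t) \<and>
      (\<exists>w. token_move G (p t) w \<and> Safe (guards_at \<sigma> p (Suc t)) w)"
    if "Safe (guards_at \<sigma> p t) (p t)" for t
    using step[OF _ _ _ president_play_in_pverts[OF wf p] that moves] legal by blast
  have safe: "Safe (guards_at \<sigma> p t) (p t)" for t
  proof (induction t)
    case 0
    then show ?case using v0 by (simp add: p_0 guards_at_def)
  next
    case (Suc t)
    then show ?case using step'[OF Suc] nxt_safe by (simp add: p_Suc)
  qed
  show False using \<sigma>(2)[OF p] step'[OF safe] by (auto simp: bodyguards_win_play_def)
qed

section \<open>Paths\<close>

lemma pair_wf_digraph_path_graph: "pair_wf_digraph (path_graph n)"
  by unfold_locales (auto simp: path_graph_def)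

lemma token_move_path_graph:
  "v < n \<Longrightarrow> token_move (path_graph n) v w \<longleftrightarrow> w < n \<and> w \<le> Suc v \<and> v \<le> Suc w"
  by (auto simp: token_move_def open_nbhd_def path_graph_def)

lemma bodyguards_win_path_graph_1: "bodyguards_win (path_graph 1) 0"
  by (rule bodyguards_winI[OF pair_wf_digraph_path_graph,
        where start = "[]" and resp = "\<lambda>_ _ _. []" and N = 0])
    (auto simp: surrounded_def open_nbhd_def path_graph_def)

lemma bodyguards_win_path_graph_2: "bodyguards_win (path_graph 2) 1"
  by (rule bodyguards_winI[OF pair_wf_digraph_path_graph,
        where start = "[0]" and resp = "\<lambda>_ _ v. [1 - v]" and N = 0])
    (auto simp: surrounded_def open_nbhd_def path_graph_def token_move_def)

text \<open>Each guard walks from its end of the path towards the president and stops next to him. At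
  the ends of the path the targets \<open>v - 1\<close> and \<open>v + 1\<close> are truncated.\<close>

lemma bodyguards_win_path_graph:
  assumes "n \<ge> 1"
  shows "bodyguards_win (path_graph n) 2"
proof (rule bodyguards_winI[OF pair_wf_digraph_path_graph,
      where start = "[0, n - 1]" and N = n
        and resp = "\<lambda>_ t v. [min (Suc t) (v - 1), max (n - 1 - Suc t) (min (v + 1) (n - 1))]"])
  show "length [0, n - 1] = 2" by simp
  show "set [0, n - 1] \<subseteq> pverts (path_graph n)" using assms by (auto simp: path_graph_def)
next
  fix u assume "u \<in> pverts (path_graph n)"
  then show "list_all2 (token_move (path_graph n)) [0, n - 1]
      [min (Suc 0) (u - 1), max (n - 1 - Suc 0) (min (u + 1) (n - 1))]"
    by (auto simp: path_graph_def[THEN arg_cong, of pverts] token_move_path_graph)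
next
  \<comment> \<open>Each walking bound and each target changes by at most one per turn, hence so do
    their minimum and maximum.\<close>
  fix t v w assume "v \<in> pverts (path_graph n)" "w \<in> pverts (path_graph n)"
    "token_move (path_graph n) v w"
  then have "v < n" "w < n" "w \<le> Suc v" "v \<le> Suc w"
    by (auto simp: path_graph_def[THEN arg_cong, of pverts] token_move_path_graph)
  then show "list_all2 (token_move (path_graph n))
      [min (Suc t) (v - 1), max (n - 1 - Suc t) (min (v + 1) (n - 1))]
      [min (Suc (Suc t)) (w - 1), max (n - 1 - Suc (Suc t)) (min (w + 1) (n - 1))]"
    by (auto simp: token_move_path_graph)
next
  \<comment> \<open>By now \<open>Suc t\<close> exceeds every target and
    \<open>n - 1 - Suc t\<close> is 0, so neither bound is active and both guards stand at their
    targets.\<close>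
  fix t v assume "v \<in> pverts (path_graph n)" "n \<le> t"
  then show "surrounded (path_graph n)
      [min (Suc t) (v - 1), max (n - 1 - Suc t) (min (v + 1) (n - 1))] v"
    by (auto simp: surrounded_def open_nbhd_def path_graph_def)
qed

section \<open>Cycles\<close>

lemma pair_wf_digraph_cycle_graph: "pair_wf_digraph (cycle_graph m)"
  by unfold_locales (auto simp: cycle_graph_def)

lemma token_move_cycle_graph:
  "token_move (cycle_graph m) v w \<longleftrightarrow>
    w = v \<or> v < m \<and> w < m \<and> (w = Suc v mod m \<or> v = Suc w mod m)"
  by (auto simp: token_move_def open_nbhd_def cycle_graph_def)

text \<open>From the start \<open>0\<close>, \<open>2\<close> the guards reach the two neighbours of any vertex of a cycle of
  length at most 5 in one turn; which guard takes which side depends on the vertex. Afterwards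
  they copy the moves of the president.\<close>

lemma bodyguards_win_cycle_graph:
  assumes "3 \<le> m" "m \<le> 5"
  shows "bodyguards_win (cycle_graph m) 2"
proof -
  have m: "m = 3 \<or> m = 4 \<or> m = 5" using assms by auto
  \<comment> \<open>Adding \<open>m\<close> keeps the predecessor \<open>v - 1\<close> from being
    truncated at 0. For \<open>u \<ge> 3\<close> the predecessor of \<open>u\<close> is two steps
    away from 0, so the guard starting there takes the successor, which is within one step.\<close>
  define resp where "resp u v =
      (if u < 3 then [(v + m - 1) mod m, Suc v mod m] else [Suc v mod m, (v + m - 1) mod m])"
    for u v :: nat
  have less: "x < 3 \<longleftrightarrow> x = 0 \<or> x = 1 \<or> x = 2"
    "x < 4 \<longleftrightarrow> x = 0 \<or> x = 1 \<or> x = 2 \<or> x = 3"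
    "x < 5 \<longleftrightarrow> x = 0 \<or> x = 1 \<or> x = 2 \<or> x = 3 \<or> x = 4" for x :: nat
    by auto
  have verts: "pverts (cycle_graph m) = {..<m}" by (simp add: cycle_graph_def)
  have first: "list_all2 (token_move (cycle_graph m)) [0, 2] (resp u u)" if "u < m" for u
    using m
  proof (elim disjE)
    assume "m = 3" then show ?thesis using that
      by (auto simp: resp_def token_move_cycle_graph less(1))
  next
    assume "m = 4" then show ?thesis using that
      by (auto simp: resp_def token_move_cycle_graph less(2))
  next
    assume "m = 5" then show ?thesis using that
      by (auto simp: resp_def token_move_cycle_graph less(3))
  qed
  have less_m: "Suc v mod m < m" "(v + m - 1) mod m < m" for v
    using assms by simp_all
  have succ_pred: "Suc ((v + m - 1) mod m) mod m = v" if "v < m" for v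
    using that assms by (simp add: mod_Suc_eq)
  have pred_succ: "(Suc v mod m + m - 1) mod m = v" if "v < m" for v
  proof (cases "Suc v = m")
    case False
    then have "Suc v mod m + m - 1 = v + m" using that by simp
    then show ?thesis using that by simp
  qed (use that in auto)
  have step: "list_all2 (token_move (cycle_graph m)) (resp u v) (resp u w)"
    if vw: "v < m" "w < m" "token_move (cycle_graph m) v w" for u v w
  proof -
    consider "w = v" | "w = Suc v mod m" | "v = Suc w mod m"
      using vw(3) by (auto simp: token_move_cycle_graph)
    then have "token_move (cycle_graph m) (Suc v mod m) (Suc w mod m) \<and>
        token_move (cycle_graph m) ((v + m - 1) mod m) ((w + m - 1) mod m)"
    proof cases
      case 1
      then show ?thesis by (simp add: token_move_cycle_graph)
    next
      case 2
      have "(w + m - 1) mod m = v" using pred_succ[OF vw(1)] 2 by simp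
      then show ?thesis
        unfolding token_move_cycle_graph using 2 vw less_m succ_pred[OF vw(1)] by metis
    next
      case 3
      have "(v + m - 1) mod m = w" using pred_succ[OF vw(2)] 3 by simp
      then show ?thesis
        unfolding token_move_cycle_graph using 3 vw less_m succ_pred[OF vw(2)] by metis
    qed
    then show ?thesis by (simp add: resp_def)
  qed
  have surr: "surrounded (cycle_graph m) (resp u v) v" for u v
    unfolding surrounded_def
  proof
    fix w assume "w \<in> open_nbhd (cycle_graph m) v"
    then have "w = Suc v mod m \<or> w < m \<and> v = Suc w mod m"
      by (auto simp: open_nbhd_def cycle_graph_def)
    then have "w = Suc v mod m \<or> w = (v + m - 1) mod m" using pred_succ by auto
    then show "w \<in> set (resp u v)" by (auto simp: resp_def)
  qed
  show ?thesis
  proof (rule bodyguards_winI[OF pair_wf_digraph_cycle_graph,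
        where start = "[0, 2]" and resp = "\<lambda>u _ v. resp u v" and N = 0])
    show "set [0, 2] \<subseteq> pverts (cycle_graph m)" using assms by (auto simp: cycle_graph_def)
  qed (use first step surr in \<open>auto simp: verts\<close>)
qed

text \<open>In coordinates relative to the president, \<open>threatens m x y\<close> says that guards at \<open>x\<close> and
  \<open>y\<close> reach \<open>- 1\<close> and \<open>1\<close>, respectively, in one turn.\<close>

definition threatens :: "int \<Rightarrow> int \<Rightarrow> int \<Rightarrow> bool" where
  "threatens m x y \<longleftrightarrow> (\<exists>d\<in>{-2, -1, 0}. m dvd x - d) \<and> (\<exists>e\<in>{0, 1, 2}. m dvd y - e)"

text \<open>Offsets between -3 and 3 are compared with values between -2 and 2. The differences have
  absolute value at most 5, so from \<open>m = 6\<close> on congruence is equality.\<close>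

lemma dvd_small_int_iff:
  fixes m c :: int
  assumes "6 \<le> m" "\<bar>c\<bar> < 6"
  shows "m dvd c \<longleftrightarrow> c = 0"
  using assms zdvd_imp_le[of m "\<bar>c\<bar>"] by auto

text \<open>Lets offsets be replaced by small representatives modulo \<open>m\<close>. The shift
  \<open>s\<close> is the president's step, so the replacement remains possible after he has
  moved.\<close>

lemma threatens_congruent:
  assumes "m dvd x - x'" "m dvd y - y'"
  shows "threatens m (x - s) (y - s) \<longleftrightarrow> threatens m (x' - s) (y' - s)"
proof -
  have "m dvd x - s - f \<longleftrightarrow> m dvd x' - s - f" "m dvd y - s - f \<longleftrightarrow> m dvd y' - s - f" for f
    using dvd_add_right_iff[OF assms(1), of "x' - s - f"] dvd_add_right_iff[OF assms(2), of "y' - s - f"]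
    by (simp_all add: algebra_simps)
  then show ?thesis by (simp add: threatens_def)
qed

lemma threatens_escape_aux:
  assumes m: "6 \<le> m" and thr: "threatens m x y" and not_surr: "\<not> (m dvd x + 1 \<and> m dvd y - 1)"
  shows "\<exists>s\<in>{-1, 1}. \<not> threatens m (x - s) (y - s) \<and> \<not> threatens m (y - s) (x - s)"
proof -
  obtain d e where de: "d \<in> {-2, -1, 0}" "m dvd x - d" "e \<in> {0, 1, 2}" "m dvd y - e"
    using thr unfolding threatens_def by blast
  note congr = threatens_congruent[OF de(2,4)] threatens_congruent[OF de(4,2)]
  have "\<not> (d = -1 \<and> e = 1)" using de(2,4) not_surr by (metis diff_minus_eq_add)
  \<comment> \<open>In the first case he steps by 1: a guard at -2 falls back to -3 and is useless
    on either side, and otherwise both offsets become negative, so that nobody can reach 1. The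
    second case is the mirror image, with a step by -1.\<close>
  then consider "d = -2 \<or> d = -1 \<and> e = 0 \<or> d = 0 \<and> e = 0" | "e = 2 \<or> d = 0 \<and> e = 1"
    using de(1,3) by auto
  then show ?thesis
  proof cases
    case 1
    then have "\<not> threatens m (d - 1) (e - 1) \<and> \<not> threatens m (e - 1) (d - 1)"
      using m by (auto simp: threatens_def dvd_small_int_iff[OF m])
    then show ?thesis using congr[of 1] by blast
  next
    case 2
    then have "\<not> threatens m (d - -1) (e - -1) \<and> \<not> threatens m (e - -1) (d - -1)"
      using m by (auto simp: threatens_def dvd_small_int_iff[OF m])
    then show ?thesis using congr[of "-1"] by blast
  qed
qed

lemma threatens_escape:
  assumes "6 \<le> m" "\<not> (m dvd x + 1 \<and> m dvd y - 1)" "\<not> (m dvd y + 1 \<and> m dvd x - 1)"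
  shows "\<exists>s\<in>{-1, 0, 1}. \<not> threatens m (x - s) (y - s) \<and> \<not> threatens m (y - s) (x - s)"
proof (cases "threatens m x y \<or> threatens m y x")
  case True
  then show ?thesis
    using threatens_escape_aux[OF assms(1) _ assms(2)] threatens_escape_aux[OF assms(1) _ assms(3)]
    by blast
next
  case False
  then show ?thesis by (intro bexI[of _ 0]) auto
qed

section \<open>From moves on the cycle to integer offsets\<close>

lemma int_dvd_mod_diff: "int m dvd int (x mod m) - int x"
  by (simp add: mod_eq_dvd_iff[symmetric] zmod_int)

lemma int_dvd_Suc_mod_diff: "int m dvd int (Suc v mod m) - int v - 1"
  using int_dvd_mod_diff[of m "Suc v"] by (simp add: algebra_simps)

lemma token_move_cycle_graph_imp_dvd:
  assumes "token_move (cycle_graph m) v w"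
  shows "\<exists>s\<in>{-1, 0, 1}. int m dvd int w - int v - s"
proof -
  consider "w = v" | "w = Suc v mod m" | "v = Suc w mod m"
    using assms by (auto simp: token_move_def open_nbhd_def cycle_graph_def)
  then show ?thesis
  proof cases
    case 3
    then have "int m dvd - (int v - int w - 1)" 
      using int_dvd_Suc_mod_diff[of m w] by (simp only: dvd_minus_iff)
    then show ?thesis by (intro bexI[of _ "-1"]) (auto simp: algebra_simps)
  qed (use int_dvd_Suc_mod_diff in auto)
qed

text \<open>Serves both sides of the argument: surrounding the president requires guards at the
  offsets -1 and 1, and an escape direction has to be realised by an actual move.\<close>

lemma cycle_graph_neighbour:
  assumes "v < m" "s \<in> {-1, 1}"
  shows "\<exists>w\<in>open_nbhd (cycle_graph m) v. int m dvd int w - int v - s"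
proof (cases "s = 1")
  case True
  have "Suc v mod m \<in> open_nbhd (cycle_graph m) v"
    using assms by (auto simp: open_nbhd_def cycle_graph_def)
  then show ?thesis using True int_dvd_Suc_mod_diff by blast
next
  case False
  then have s: "s = -1" using assms by auto
  let ?w = "(v + (m - 1)) mod m"
  have v: "v = Suc ?w mod m"
    using assms by (simp add: mod_Suc_eq)
  then have "?w \<in> open_nbhd (cycle_graph m) v"
    using assms by (auto simp: open_nbhd_def cycle_graph_def)
  moreover have "int m dvd - (int v - int ?w - 1)"
    using int_dvd_Suc_mod_diff[of m ?w] v by (simp only: dvd_minus_iff)
  then have "int m dvd int ?w - int v - s"
    by (simp add: s algebra_simps)
  ultimately show ?thesis by blast
qed

lemma not_bodyguards_win_cycle_graph:
  assumes "6 \<le> m"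
  shows "\<not> bodyguards_win (cycle_graph m) 2"
\<comment> \<open>Either guard may take either side, so safety excludes both assignments.\<close>
proof (rule not_bodyguards_winI[OF pair_wf_digraph_cycle_graph, where Safe = "\<lambda>gs v.
      \<not> threatens (int m) (int (gs ! 0) - int v) (int (gs ! 1) - int v) \<and>
      \<not> threatens (int m) (int (gs ! 1) - int v) (int (gs ! 0) - int v)"])
  have m: "6 \<le> int m" using assms by simp
  {
    fix gs :: "nat list"
    \<comment> \<open>Three steps from the first guard: its offset -3 is none of -2, ..., 2 modulo
      \<open>m\<close>, so it threatens from neither side, wherever the second guard is.\<close>
    let ?v = "(gs ! 0 + 3) mod m"
    have v: "int m dvd - (int ?v - int (gs ! 0 + 3))"
      unfolding dvd_minus_iff by (rule int_dvd_mod_diff)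
    have far: "\<not> int m dvd int (gs ! 0) - int ?v - d" if "d \<in> {-2..2}" for d
    proof -
      have "int m dvd int (gs ! 0) - int ?v - d \<longleftrightarrow> int m dvd -3 - d"
        using dvd_add_right_iff[OF v, of "-3 - d"] by (simp add: algebra_simps)
      then show ?thesis using that dvd_small_int_iff[OF m, of "-3 - d"] by simp
    qed
    have "?v \<in> pverts (cycle_graph m)" using assms by (simp add: cycle_graph_def)
    moreover have "\<not> threatens (int m) (int (gs ! 0) - int ?v) y"
      "\<not> threatens (int m) y (int (gs ! 0) - int ?v)" for y
      using far[of "-2"] far[of "-1"] far[of 0] far[of 1] far[of 2] by (auto simp: threatens_def)
    ultimately show "\<exists>v\<in>pverts (cycle_graph m).
        \<not> threatens (int m) (int (gs ! 0) - int v) (int (gs ! 1) - int v) \<and>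
        \<not> threatens (int m) (int (gs ! 1) - int v) (int (gs ! 0) - int v)"
      by blast
  }
  fix gs gs' v
  assume len: "length gs = 2" and v: "v \<in> pverts (cycle_graph m)"
    and safe: "\<not> threatens (int m) (int (gs ! 0) - int v) (int (gs ! 1) - int v) \<and>
      \<not> threatens (int m) (int (gs ! 1) - int v) (int (gs ! 0) - int v)"
    and moves: "list_all2 (token_move (cycle_graph m)) gs gs'"
  define a b a' b' where ab: "a = int (gs ! 0) - int v" "b = int (gs ! 1) - int v"
    "a' = int (gs' ! 0) - int v" "b' = int (gs' ! 1) - int v"
  have v: "v < m" using v by (simp add: cycle_graph_def)
  have gs': "gs' = [gs' ! 0, gs' ! 1]"
  proof -
    have "length gs' = Suc (Suc 0)" using list_all2_lengthD[OF moves] len by simp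
    then obtain x y where "gs' = [x, y]" by (auto simp: length_Suc_conv)
    then show ?thesis by simp
  qed
  have moves': "token_move (cycle_graph m) (gs ! 0) (gs' ! 0)"
      "token_move (cycle_graph m) (gs ! 1) (gs' ! 1)"
    using moves len by (auto simp: list_all2_conv_all_nth)
  have "a' - a = int (gs' ! 0) - int (gs ! 0)" "b' - b = int (gs' ! 1) - int (gs ! 1)"
    by (simp_all add: ab)
  then obtain s t where st: "s \<in> {-1, 0, 1}" "int m dvd a' - a - s"
      "t \<in> {-1, 0, 1}" "int m dvd b' - b - t"
    using moves'[THEN token_move_cycle_graph_imp_dvd] by metis
  \<comment> \<open>Runs a guard's move backwards: guards now at offsets -1 and 1 were within one
    step of them before, so the earlier position was threatening and not safe.\<close>
  have undo: "\<exists>d\<in>{c - 1, c, c + 1}. int m dvd x - d"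
    if "int m dvd x' - x - r" "r \<in> {-1, 0, 1}" "int m dvd x' - c" for x x' r c
  proof -
    have "int m dvd (x' - c) - (x' - x - r)" using that(3,1) by (rule dvd_diff)
    then have "int m dvd x - (c - r)" by (simp add: algebra_simps)
    then show ?thesis using that(2) by (intro bexI[of _ "c - r"]) auto
  qed
  have ns1: "\<not> (int m dvd a' + 1 \<and> int m dvd b' - 1)"
    using safe undo[OF st(2,1), of "-1"] undo[OF st(4,3), of 1] by (auto simp: threatens_def ab)
  have ns2: "\<not> (int m dvd b' + 1 \<and> int m dvd a' - 1)"
    using safe undo[OF st(2,1), of 1] undo[OF st(4,3), of "-1"] by (auto simp: threatens_def ab)
  \<comment> \<open>A single guard cannot hold both sides, as \<open>m\<close> does not divide
    2.\<close>
  have not2: "\<not> (int m dvd x + 1 \<and> int m dvd x - 1)" for x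
  proof
    assume "int m dvd x + 1 \<and> int m dvd x - 1"
    then have "int m dvd (x + 1) - (x - 1)" by (blast intro: dvd_diff)
    then show False using dvd_small_int_iff[OF m, of 2] by simp
  qed
  have "\<not> surrounded (cycle_graph m) gs' v"
  proof
    assume s: "surrounded (cycle_graph m) gs' v"
    obtain w w' where w: "w \<in> open_nbhd (cycle_graph m) v" "int m dvd int w - int v - 1"
      "w' \<in> open_nbhd (cycle_graph m) v" "int m dvd int w' - int v - -1"
      using cycle_graph_neighbour[OF v, of 1] cycle_graph_neighbour[OF v, of "-1"] by blast
    then have "w \<in> {gs' ! 0, gs' ! 1}" "w' \<in> {gs' ! 0, gs' ! 1}"
      using s gs' unfolding surrounded_def by (metis list.simps(15) empty_set subsetD)+
    then have "int m dvd a' - 1 \<or> int m dvd b' - 1" "int m dvd a' + 1 \<or> int m dvd b' + 1"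
      using w by (auto simp: ab)
    then show False using ns1 ns2 not2 by blast
  qed
  moreover have "\<exists>w. token_move (cycle_graph m) v w \<and>
      \<not> threatens (int m) (int (gs' ! 0) - int w) (int (gs' ! 1) - int w) \<and>
      \<not> threatens (int m) (int (gs' ! 1) - int w) (int (gs' ! 0) - int w)"
  proof -
    obtain r where r: "r \<in> {-1, 0, 1}" "\<not> threatens (int m) (a' - r) (b' - r)"
        "\<not> threatens (int m) (b' - r) (a' - r)"
      using threatens_escape[OF m ns1 ns2] by blast
    have "\<exists>w. token_move (cycle_graph m) v w \<and> int m dvd int w - int v - r"
    proof (cases "r = 0")
      case True
      then show ?thesis by (intro exI[of _ v]) (simp add: token_move_def)
    next
      case False
      then show ?thesis
        using cycle_graph_neighbour[OF v, of r] r(1) unfolding token_move_def by blast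
    qed
    then obtain w where w: "token_move (cycle_graph m) v w" "int m dvd int w - int v - r"
      by blast
    \<comment> \<open>Measuring from \<open>w\<close> instead of \<open>v\<close> lowers every
      offset by \<open>r\<close> modulo \<open>m\<close>.\<close>
    have "int m dvd int x - int w - (int x - int v - r)" for x
      using dvd_minus_iff[of "int m" "int w - int v - r"] w(2) by (simp add: algebra_simps)
    then have "threatens (int m) (int x - int w) (int y - int w) \<longleftrightarrow>
        threatens (int m) (int x - int v - r) (int y - int v - r)" for x y
      using threatens_congruent[of "int m" _ _ _ _ 0] by simp
    then show ?thesis using w(1) r by (auto simp: ab)
  qed
  ultimately show "\<not> surrounded (cycle_graph m) gs' v \<and> (\<exists>w. token_move (cycle_graph m) v w \<and>
      \<not> threatens (int m) (int (gs' ! 0) - int w) (int (gs' ! 1) - int w) \<and>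
      \<not> threatens (int m) (int (gs' ! 1) - int w) (int (gs' ! 0) - int w))" ..
qed

section \<open>Connected graphs of maximum degree two\<close>

text \<open>\<open>connected\<close> refers to the symmetric closure. As \<open>G\<close> is
  symmetric, the closure has no additional arcs, so a walk that starts in \<open>S\<close> never
  leaves it.\<close>

lemma connected_closed_eq_pverts:
  assumes "pair_graph G" "connected (with_proj G)"
    and "S \<subseteq> pverts G" "S \<noteq> {}"
    and closed: "\<And>v. v \<in> S \<Longrightarrow> open_nbhd G v \<subseteq> S"
  shows "S = pverts G"
proof
  show "S \<subseteq> pverts G" by fact
  interpret pair_graph G by fact
  let ?H = "mk_symmetric (with_proj G)"
  have arcs: "parcs ?H \<subseteq> parcs G"
    using arcs_symmetric by (auto simp: mk_symmetric_def)
  obtain u where u: "u \<in> S" using \<open>S \<noteq> {}\<close> by blast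
  show "pverts G \<subseteq> S"
  proof
    fix v assume "v \<in> pverts G"
    then have "u \<rightarrow>\<^sup>*\<^bsub>with_proj ?H\<^esub> v"
      using assms(2,3) u by (auto simp: connected_def strongly_connected_def mk_symmetric_def)
    then have "(u, v) \<in> rtrancl_on (pverts ?H) (parcs ?H)"
      by (simp add: reachable_def)
    then show "v \<in> S"
    proof (induction rule: rtrancl_on_induct)
      case base
      show ?case by (rule u)
    next
      case (step x y)
      then show ?case using arcs closed by (auto simp: open_nbhd_def)
    qed
  qed
qed

definition path_list :: "'a pair_pre_digraph \<Rightarrow> 'a list \<Rightarrow> bool" where
  "path_list G xs \<longleftrightarrow> xs \<noteq> [] \<and> distinct xs \<and> set xs \<subseteq> pverts G \<and>
    (\<forall>i. Suc i < length xs \<longrightarrow> (xs ! i, xs ! Suc i) \<in> parcs G)"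

lemma path_list_Cons:
  assumes "path_list G xs" "w \<in> pverts G" "w \<notin> set xs" "(w, xs ! 0) \<in> parcs G"
  shows "path_list G (w # xs)"
  using assms by (auto simp: path_list_def nth_Cons split: nat.split)

lemma path_list_snoc:
  assumes "path_list G xs" "w \<in> pverts G" "w \<notin> set xs" "(xs ! (length xs - 1), w) \<in> parcs G"
  shows "path_list G (xs @ [w])"
proof -
  have "((xs @ [w]) ! i, (xs @ [w]) ! Suc i) \<in> parcs G" if "i < length xs" for i
  proof (cases "Suc i = length xs")
    case True
    then have "i = length xs - 1" by simp
    then show ?thesis using that True assms(4) by (simp add: nth_append)
  next
    case False
    then show ?thesis using that assms(1) by (simp add: nth_append path_list_def)
  qed
  then show ?thesis using assms by (simp add: path_list_def)
qed

text \<open>A longest path leaves no room for further vertices: its inner vertices already have two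
  neighbours on it, and its ends cannot be extended.\<close>

lemma connected_max_degree_two:
  assumes G: "pair_graph G" and con: "connected (with_proj G)"
    and deg: "\<And>v. v \<in> pverts G \<Longrightarrow> card (open_nbhd G v) \<le> 2"
  shows "(\<exists>n\<ge>1. digraph_iso (with_proj G) (with_proj (path_graph n))) \<or>
    (\<exists>m\<ge>3. digraph_iso (with_proj G) (with_proj (cycle_graph m)))"
proof -
  interpret pair_graph G by fact
  have wf: "pair_wf_digraph G" by (rule pair_wf_digraph)
  have sym: "(u, v) \<in> parcs G \<longleftrightarrow> (v, u) \<in> parcs G" for u v
    using arcs_symmetric by blast
  have irrefl: "(u, u) \<notin> parcs G" for u using pair_no_loops by fastforce
  obtain v where "v \<in> pverts G"
    using con by (auto simp: connected_def strongly_connected_def mk_symmetric_def)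
  then have "path_list G [v]" by (simp add: path_list_def)
  moreover have "length xs \<le> card (pverts G)" if "path_list G xs" for xs
    using that card_mono[OF pair_finite_verts, of "set xs"] by (auto simp: path_list_def distinct_card)
  ultimately have "\<exists>xs. path_list G xs \<and> (\<forall>ys. path_list G ys \<longrightarrow> length ys \<le> length xs)"
    by (intro ex_has_greatest_nat[of _ "[v]" _ "Suc (card (pverts G))"]) (auto simp: less_Suc_eq_le)
  then obtain xs where path: "path_list G xs"
    and longest: "\<And>ys. path_list G ys \<Longrightarrow> length ys \<le> length xs"
    by blast
  define n where "n = length xs"
  have n: "0 < n" and dist: "distinct xs" and verts: "set xs \<subseteq> pverts G"
    and edge: "\<And>i. Suc i < n \<Longrightarrow> (xs ! i, xs ! Suc i) \<in> parcs G"
    using path by (auto simp: path_list_def n_def)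
  have nth_eq: "xs ! i = xs ! j \<longleftrightarrow> i = j" if "i < n" "j < n" for i j
    using that dist by (simp add: nth_eq_iff_index_eq n_def)
  have nth_in: "xs ! i \<in> pverts G" if "i < n" for i
    using that verts by (auto simp: n_def)
  have inner: "open_nbhd G (xs ! i) = {xs ! (i - 1), xs ! Suc i}" if "0 < i" "Suc i < n" for i
  proof (rule card_seteq[symmetric])
    have "finite (pverts G)" by (rule pair_finite_verts)
    then show "finite (open_nbhd G (xs ! i))"
      using open_nbhd_subset_pverts[OF wf] by (rule rev_finite_subset)
    show "{xs ! (i - 1), xs ! Suc i} \<subseteq> open_nbhd G (xs ! i)"
      using edge[of "i - 1"] edge[of i] that by (auto simp: open_nbhd_def sym)
    have "card {xs ! (i - 1), xs ! Suc i} = 2" using that nth_eq by simp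
    then show "card (open_nbhd G (xs ! i)) \<le> card {xs ! (i - 1), xs ! Suc i}"
      using deg[OF nth_in, of i] that by simp
  qed
  have closed: "open_nbhd G v \<subseteq> set xs" if v: "v \<in> set xs" for v
  proof
    fix w assume w: "w \<in> open_nbhd G v"
    then have w_in: "w \<in> pverts G" using open_nbhd_subset_pverts[OF wf] by blast
    obtain i where i: "i < n" "v = xs ! i" using v by (auto simp: in_set_conv_nth n_def)
    consider "i = 0" | "i = n - 1" | "0 < i" "Suc i < n" using i by linarith
    then show "w \<in> set xs"
    proof cases
      case 1
      then have "(w, xs ! 0) \<in> parcs G" using w i sym by (simp add: open_nbhd_def)
      then show ?thesis using longest[OF path_list_Cons[OF path w_in]] by fastforce
    next
      case 2
      then have "(xs ! (length xs - 1), w) \<in> parcs G" using w i by (simp add: open_nbhd_def n_def)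
      then show ?thesis using longest[OF path_list_snoc[OF path w_in]] by fastforce
    next
      case 3
      then show ?thesis using w i inner by (auto simp: n_def)
    qed
  qed
  have all: "set xs = pverts G"
    using connected_closed_eq_pverts[OF G con verts] closed path by (auto simp: path_list_def)
  have bij: "bij_betw ((!) xs) {..<n} (pverts G)"
    using bij_betw_nth[OF dist] all by (simp add: n_def)
  let ?e = "(xs ! 0, xs ! (n - 1)) \<in> parcs G"
  \<comment> \<open>An arc between non-consecutive vertices of the path would give an inner vertex a
    third neighbour, so it can only join the two ends; \<open>?e\<close> records whether these are
    adjacent.\<close>
  have arcs_less: "(xs ! i, xs ! j) \<in> parcs G \<longleftrightarrow> j = Suc i \<or> i = 0 \<and> j = n - 1 \<and> ?e"
    if ij_less: "i < j" "j < n" for i j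
  proof
    assume ij: "(xs ! i, xs ! j) \<in> parcs G"
    consider "0 < i" | "i = 0" "Suc j < n" | "i = 0" "j = n - 1" using ij_less by linarith
    then show "j = Suc i \<or> i = 0 \<and> j = n - 1 \<and> ?e"
    proof cases
      case 1
      then have "xs ! j = xs ! (i - 1) \<or> xs ! j = xs ! Suc i"
        using ij inner[of i] that by (auto simp: open_nbhd_def)
      then show ?thesis using that nth_eq by auto
    next
      case 2
      then have "xs ! i = xs ! (j - 1) \<or> xs ! i = xs ! Suc j"
        using ij inner[of j] that sym by (auto simp: open_nbhd_def)
      then show ?thesis using 2 that nth_eq by auto
    qed (use ij in auto)
  qed (use edge that in auto)
  have arcs: "(xs ! i, xs ! j) \<in> parcs G \<longleftrightarrow>
      j = Suc i \<or> i = Suc j \<or> ?e \<and> (i = 0 \<and> j = n - 1 \<or> j = 0 \<and> i = n - 1)"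
    if "i < n" "j < n" for i j
    using that arcs_less[of i j] arcs_less[of j i] sym[of "xs ! i" "xs ! j"] irrefl[of "xs ! i"]
    by (cases i j rule: linorder_cases) auto
  \<comment> \<open>Adjacent ends close the path to a cycle only for \<open>n \<ge> 3\<close>. For
    \<open>n = 2\<close> the arc \<open>?e\<close> is the edge of the path itself, and for
    \<open>n = 1\<close> it would be a loop.\<close>
  show ?thesis
  proof (cases "?e \<and> 3 \<le> n")
    case True
    have wrap: "j = Suc i mod n \<longleftrightarrow> j = Suc i \<or> i = n - 1 \<and> j = 0" if "i < n" "j < n" for i j
      using that by (cases "Suc i = n") auto
    have "(i, j) \<in> parcs (cycle_graph n) \<longleftrightarrow> (xs ! i, xs ! j) \<in> parcs G" if ij: "i < n" "j < n" for i j
    proof -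
      have "(i, j) \<in> parcs (cycle_graph n) \<longleftrightarrow> j = Suc i mod n \<or> i = Suc j mod n"
        using ij by (simp add: cycle_graph_def)
      then show ?thesis
        unfolding arcs[OF ij] wrap[OF ij] wrap[OF ij(2,1)] using True by blast
    qed
    then have "pair_isomorphism ((!) xs) (cycle_graph n) G"
      using bij by (simp add: pair_isomorphism_def cycle_graph_def[THEN arg_cong, of pverts])
    then have "digraph_iso (with_proj G) (with_proj (cycle_graph n))"
      unfolding digraph_iso_with_proj_iff[OF wf pair_wf_digraph_cycle_graph]
      by (intro exI) (rule pair_isomorphism_the_inv_into)
    then show ?thesis using True by blast
  next
    case False
    have n_2: "n = 2" if e: ?e
    proof -
      have "n \<noteq> 1" using e irrefl[of "xs ! 0"] by auto
      then show ?thesis using e False n by linarith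
    qed
    have "(i, j) \<in> parcs (path_graph n) \<longleftrightarrow> (xs ! i, xs ! j) \<in> parcs G" if ij: "i < n" "j < n" for i j
    proof -
      have "(i, j) \<in> parcs (path_graph n) \<longleftrightarrow> j = Suc i \<or> i = Suc j"
        using ij by (simp add: path_graph_def)
      then show ?thesis
        unfolding arcs[OF ij] using n_2 by fastforce
    qed
    then have "pair_isomorphism ((!) xs) (path_graph n) G"
      using bij by (simp add: pair_isomorphism_def path_graph_def[THEN arg_cong, of pverts])
    then have "digraph_iso (with_proj G) (with_proj (path_graph n))"
      unfolding digraph_iso_with_proj_iff[OF wf pair_wf_digraph_path_graph]
      by (intro exI) (rule pair_isomorphism_the_inv_into)
    then show ?thesis using n by (intro disjI1 exI[of _ n]) simp
  qed
qed

section \<open>Bodyguard numbers\<close>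

lemma bodyguards_win_bodyguard_number:
  "pair_graph G \<Longrightarrow> bodyguards_win G (bodyguard_number G)"
  unfolding bodyguard_number_def by (rule LeastI) (rule bodyguards_win_card)

lemma bodyguard_number_le: "bodyguards_win G k \<Longrightarrow> bodyguard_number G \<le> k"
  unfolding bodyguard_number_def by (rule Least_le)

lemma bodyguard_number_ge_2:
  assumes G: "pair_graph G" and v: "v \<in> pverts G"
    and uw: "u \<in> open_nbhd G v" "w \<in> open_nbhd G v" "u \<noteq> w"
  shows "2 \<le> bodyguard_number G"
proof -
  interpret pair_graph G by fact
  have "finite (open_nbhd G v)"
    using pair_finite_verts open_nbhd_subset_pverts[OF pair_wf_digraph] by (rule rev_finite_subset)
  then have "card {u, w} \<le> card (open_nbhd G v)"
    using uw by (intro card_mono) auto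
  also have "\<dots> \<le> bodyguard_number G"
    by (rule bodyguards_win_imp_card_open_nbhd_le[OF pair_wf_digraph
          bodyguards_win_bodyguard_number[OF G] v])
  finally show ?thesis using uw by simp
qed

lemma pair_graph_path_graph: "pair_graph (path_graph n)"
proof -
  interpret pair_wf_digraph "path_graph n" by (rule pair_wf_digraph_path_graph)
  have "finite ({..<n} \<times> {..<n})" by simp
  then have "finite (parcs (path_graph n))"
    by (rule rev_finite_subset) (auto simp: path_graph_def)
  then show ?thesis
    by unfold_locales (auto simp: path_graph_def symmetric_def sym_def)
qed

lemma pair_graph_cycle_graph:
  assumes "2 \<le> m"
  shows "pair_graph (cycle_graph m)"
proof -
  interpret pair_wf_digraph "cycle_graph m" by (rule pair_wf_digraph_cycle_graph)
  have "finite ({..<m} \<times> {..<m})" by simp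
  then have "finite (parcs (cycle_graph m))"
    by (rule rev_finite_subset) (auto simp: cycle_graph_def)
  moreover have no_loop: "Suc i mod m \<noteq> i" if "i < m" for i
    using assms that by (cases "Suc i = m") auto
  ultimately show ?thesis
  proof unfold_locales
    show "fst e \<noteq> snd e" if "e \<in> parcs (cycle_graph m)" for e
      using that no_loop[of "fst e"] by (cases e) (auto simp: cycle_graph_def dest: sym)
  qed (auto simp: cycle_graph_def symmetric_def sym_def)
qed

lemma bodyguard_number_path_graph_1: "bodyguard_number (path_graph 1) = 0"
  using bodyguard_number_le[OF bodyguards_win_path_graph_1] by simp

lemma bodyguard_number_path_graph_2: "bodyguard_number (path_graph 2) = 1"
proof (rule antisym[OF bodyguard_number_le[OF bodyguards_win_path_graph_2]])
  have "open_nbhd (path_graph 2) 0 = {1}" by (auto simp: open_nbhd_def path_graph_def)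
  then show "1 \<le> bodyguard_number (path_graph 2)"
    using bodyguards_win_imp_card_open_nbhd_le[OF pair_wf_digraph_path_graph
        bodyguards_win_bodyguard_number[OF pair_graph_path_graph], of 0 2]
    by (simp add: path_graph_def[THEN arg_cong, of pverts])
qed

lemma bodyguard_number_path_graph:
  assumes "3 \<le> n"
  shows "bodyguard_number (path_graph n) = 2"
proof (rule antisym)
  show "bodyguard_number (path_graph n) \<le> 2"
    using assms by (intro bodyguard_number_le bodyguards_win_path_graph) simp
  show "2 \<le> bodyguard_number (path_graph n)"
    by (rule bodyguard_number_ge_2[OF pair_graph_path_graph, of 1 _ 0 2])
      (use assms in \<open>auto simp: open_nbhd_def path_graph_def\<close>)
qed

lemma bodyguard_number_cycle_graph_ge_2:
  assumes "3 \<le> m"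
  shows "2 \<le> bodyguard_number (cycle_graph m)"
  \<comment> \<open>Vertex 1 has the neighbours 0 and 2, which are distinct and need no wrap-around
    for \<open>m \<ge> 3\<close>.\<close>
  by (rule bodyguard_number_ge_2[OF pair_graph_cycle_graph, of _ 1 0 2])
    (use assms in \<open>auto simp: open_nbhd_def cycle_graph_def\<close>)

lemma bodyguard_number_cycle_graph_eq_2_iff:
  assumes "3 \<le> m"
  shows "bodyguard_number (cycle_graph m) = 2 \<longleftrightarrow> m \<le> 5"
proof
  assume "bodyguard_number (cycle_graph m) = 2"
  then have "bodyguards_win (cycle_graph m) 2"
    using assms bodyguards_win_bodyguard_number[OF pair_graph_cycle_graph, of m] by simp
  then show "m \<le> 5" using not_bodyguards_win_cycle_graph[of m] by fastforce
next
  assume "m \<le> 5"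
  then show "bodyguard_number (cycle_graph m) = 2"
    using assms bodyguard_number_le[OF bodyguards_win_cycle_graph]
      bodyguard_number_cycle_graph_ge_2[OF assms] by (intro antisym)
qed

theorem theorem3p4:
  fixes G :: "'a pair_pre_digraph"
  assumes "pair_graph G"
    and "connected (with_proj G)"
  shows "(bodyguard_number G = 1 \<longleftrightarrow>
            digraph_iso (with_proj G) (with_proj (path_graph 2))) \<and>
         (bodyguard_number G = 2 \<longleftrightarrow>
            (\<exists>n\<ge>3. digraph_iso (with_proj G) (with_proj (path_graph n))) \<or>
            (\<exists>m. 3 \<le> m \<and> m \<le> 5 \<and> digraph_iso (with_proj G) (with_proj (cycle_graph m))))"
proof -
  interpret pair_graph G by fact
  have wf: "pair_wf_digraph G" by (rule pair_wf_digraph)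
  have path: "bodyguard_number G = (if n = 1 then 0 else if n = 2 then 1 else 2)"
    if "1 \<le> n" "digraph_iso (with_proj G) (with_proj (path_graph n))" for n
    using that bodyguard_number_digraph_iso[OF wf pair_wf_digraph_path_graph that(2)]
      bodyguard_number_path_graph_1 bodyguard_number_path_graph_2 bodyguard_number_path_graph[of n]
    by auto
  have cycle: "bodyguard_number G = 2 \<longleftrightarrow> m \<le> 5" "bodyguard_number G \<noteq> 1"
    if m: "3 \<le> m" "digraph_iso (with_proj G) (with_proj (cycle_graph m))" for m
  proof -
    have eq: "bodyguard_number G = bodyguard_number (cycle_graph m)"
      by (rule bodyguard_number_digraph_iso[OF wf pair_wf_digraph_cycle_graph m(2)])
    show "bodyguard_number G = 2 \<longleftrightarrow> m \<le> 5" "bodyguard_number G \<noteq> 1"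
      unfolding eq using bodyguard_number_cycle_graph_eq_2_iff[OF m(1)]
        bodyguard_number_cycle_graph_ge_2[OF m(1)] by simp_all
  qed
  have path_or_cycle: "(\<exists>n\<ge>1. digraph_iso (with_proj G) (with_proj (path_graph n))) \<or>
      (\<exists>m\<ge>3. digraph_iso (with_proj G) (with_proj (cycle_graph m)))"
    if "bodyguard_number G \<le> 2"
    using bodyguards_win_imp_card_open_nbhd_le[OF wf bodyguards_win_bodyguard_number[OF assms(1)]] that
    by (intro connected_max_degree_two[OF assms]) (meson le_trans)
  \<comment> \<open>The value 1 rules out \<open>n = 1\<close> (value 0), longer paths (value 2) and
    all cycles (value at least 2).\<close>
  have one: "digraph_iso (with_proj G) (with_proj (path_graph 2))" if "bodyguard_number G = 1"
    using path_or_cycle that path cycle(2) by (metis one_le_numeral one_neq_zero zero_neq_numeral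
        n_not_Suc_n numeral_2_eq_2 One_nat_def)
  have two: "(\<exists>n\<ge>3. digraph_iso (with_proj G) (with_proj (path_graph n))) \<or>
      (\<exists>m. 3 \<le> m \<and> m \<le> 5 \<and> digraph_iso (with_proj G) (with_proj (cycle_graph m)))"
    if B: "bodyguard_number G = 2"
  proof -
    consider n where "1 \<le> n" "digraph_iso (with_proj G) (with_proj (path_graph n))"
      | m where "3 \<le> m" "digraph_iso (with_proj G) (with_proj (cycle_graph m))"
      using path_or_cycle B by auto
    then show ?thesis
    proof cases
      case (1 n)
      then have "n \<noteq> 1" "n \<noteq> 2" using path[OF 1] B by auto
      then have "3 \<le> n" using 1(1) by simp
      then show ?thesis using 1(2) by blast
    next
      case (2 m)
      then show ?thesis using cycle(1)[OF 2] B by blast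
    qed
  qed
  have "bodyguard_number G = 1" if "digraph_iso (with_proj G) (with_proj (path_graph 2))"
    using path[OF _ that] by simp
  moreover have "bodyguard_number G = 2"
    if "3 \<le> n" "digraph_iso (with_proj G) (with_proj (path_graph n))" for n
    using path[OF _ that(2)] that(1) by simp
  ultimately show ?thesis using one two cycle(1) by blast
qed

end
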